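(* For every integer $n\ge 0$ let $L_n(x)=\sum_{r=0}^n \binom{n}{r}\frac{(-1)^r}{r!}x^r$ be the $n$-th standard Laguerre polynomial, and let $$p_n(x)=\sum_{r=0}^n\sum_{l=0}^r \frac{\binom{n}{r}\binom{r}{l}(-1)^r}{l!}\,x^r .$$ Then for every integer $n\ge 0$, $$L_n(x)=\Big(\sum_{k=0}^\infty \frac{p_k(x)}{k!}D^k\Big)[x^n].$$
   Context: $D$ denotes differentiation with respect to $x$; the operator $\sum_{k=0}^\infty \frac{p_k(x)}{k!}D^k$ acts on a polynomial $f$ by $f\mapsto\sum_{k=0}^\infty \frac{p_k(x)}{k!}f^{(k)}(x)$, a finite sum. The standard Laguerre polynomials are the case $\alpha=0$ of $L_n^\alpha(x)=\sum_{r=0}^n \frac{(-1)^r}{r!}\binom{n+\alpha}{n-r}x^r$. *)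

theory Defs
  imports "HOL-Computational_Algebra.Polynomial" "HOL-Library.Groups_Big_Fun"
begin

definition laguerre :: "nat \<Rightarrow> real poly" where
  "laguerre n = (\<Sum>r = 0..n. monom (of_nat (n choose r) * ((- 1) ^ r / fact r)) r)"

definition p_poly :: "nat \<Rightarrow> real poly" where
  "p_poly n = (\<Sum>r = 0..n. \<Sum>l = 0..r.
     monom (of_nat (n choose r) * of_nat (r choose l) * (- 1) ^ r / fact l) r)"

text \<open>The operator \<open>\<Sum>\<^sub>k p\<^sub>k(x)/k! D\<^sup>k\<close>, for an arbitrary coefficient sequence \<open>p\<close>.
  \<^const>\<open>Sum_any\<close> is the sum over the set of indices with nonzero summand, and is 0 if that
  set is infinite; lemma \<open>finite_diff_op_support\<close> shows that it is always finite here.\<close>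

definition diff_op :: "(nat \<Rightarrow> real poly) \<Rightarrow> real poly \<Rightarrow> real poly" where
  "diff_op p f = Sum_any (\<lambda>k. smult (1 / fact k) (p k) * (pderiv ^^ k) f)"

lemma higher_pderiv_eq_0:
  fixes f :: "real poly"
  assumes "degree f < k"
  shows "(pderiv ^^ k) f = 0"
  using assms by (intro poly_eqI) (simp add: coeff_higher_pderiv coeff_eq_0)

lemma finite_diff_op_support:
  fixes f :: "real poly"
  shows "finite {k. smult (1 / fact k) (p k) * (pderiv ^^ k) f \<noteq> 0}"
proof (rule finite_subset)
  show "{k. smult (1 / fact k) (p k) * (pderiv ^^ k) f \<noteq> 0} \<subseteq> {..degree f}"
    using higher_pderiv_eq_0 by (auto simp: not_less[symmetric])
qed simp

end

theory Submission
  imports Defs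
begin

text \<open>
  The operator sends \<open>x^n\<close> to \<open>\<Sum>k. (n choose k) x^(n-k) p\<^sub>k(x)\<close>. By
  \<open>(n choose j) ((n-j) choose (m-j)) = (n choose m) (m choose j)\<close>, the coefficient of \<open>x^m\<close> in this sum
  is \<open>n choose m\<close> times the alternating binomial transform at \<open>m\<close> of \<open>c r = \<Sum>l. (r choose l) / l!\<close>.
  As \<open>c\<close> is itself the binomial transform of \<open>1 / l!\<close>, inversion yields \<open>(-1)^m / m!\<close>.
\<close>

text \<open>After exchanging the sums, the coefficient of \<open>a l\<close> is an alternating sum
  that collapses to a multiple of \<open>(-1 + 1) ^ (m - l)\<close>, so only \<open>l = m\<close>
  survives.\<close>

lemma binomial_inversion:
  fixes a :: "nat \<Rightarrow> 'a::comm_ring_1"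
  shows "(\<Sum>r\<le>m. of_nat (m choose r) * (-1) ^ r * (\<Sum>l\<le>r. of_nat (r choose l) * a l)) = (-1) ^ m * a m"
proof -
  have alt: "(\<Sum>r\<le>m. of_nat (m choose r) * of_nat (r choose l) * (-1) ^ r)
      = (if l = m then (-1) ^ m else (0::'a))" if "l \<le> m" for l
  proof -
    have "(\<Sum>r\<le>m. of_nat (m choose r) * of_nat (r choose l) * (-1) ^ r :: 'a)
        = (\<Sum>r\<in>{l..m}. of_nat (m choose r) * of_nat (r choose l) * (-1) ^ r)"
      by (rule sum.mono_neutral_right) (auto simp: binomial_eq_0)
    \<comment> \<open>\<open>choose_mult\<close> needs \<open>l\<close> \<le> \<open>r\<close> \<le>
      \<open>m\<close>, hence the restricted range; it frees \<open>m choose l\<close> from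
      \<open>r\<close>.\<close>
    also have "\<dots> = (\<Sum>r\<in>{l..m}. of_nat (m choose l) * (of_nat ((m - l) choose (r - l)) * (-1) ^ r))"
      by (intro sum.cong refl) (simp only: choose_mult atLeastAtMost_iff mult.assoc[symmetric] of_nat_mult[symmetric])
    also have "\<dots> = (\<Sum>i\<le>m - l. of_nat (m choose l) * (of_nat ((m - l) choose i) * (-1) ^ (i + l)))"
      using that by (intro sum.reindex_bij_witness[of _ "\<lambda>i. i + l" "\<lambda>r. r - l"]) auto
    also have "\<dots> = of_nat (m choose l) * (-1) ^ l * (\<Sum>i\<le>m - l. of_nat ((m - l) choose i) * (-1) ^ i * 1 ^ (m - l - i))"
      by (simp add: sum_distrib_left power_add algebra_simps)
    also have "\<dots> = of_nat (m choose l) * (-1) ^ l * (-1 + 1) ^ (m - l)"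
      by (simp only: binomial_ring)
    finally show ?thesis using that by (auto simp: power_0_left)
  qed
  \<comment> \<open>Padding the inner sum with zero terms up to \<open>m\<close> makes its range
    independent of \<open>r\<close>, so the sums can be exchanged.\<close>
  have "(\<Sum>r\<le>m. of_nat (m choose r) * (-1) ^ r * (\<Sum>l\<le>r. of_nat (r choose l) * a l))
      = (\<Sum>r\<le>m. of_nat (m choose r) * (-1) ^ r * (\<Sum>l\<le>m. of_nat (r choose l) * a l))"
    by (intro sum.cong refl arg_cong2[where f = "(*)"] sum.mono_neutral_left) (auto simp: binomial_eq_0)
  also have "\<dots> = (\<Sum>l\<le>m. (\<Sum>r\<le>m. of_nat (m choose r) * of_nat (r choose l) * (-1) ^ r) * a l)"
    unfolding sum_distrib_left sum_distrib_right
    by (subst sum.swap) (simp add: mult_ac)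
  also have "\<dots> = (\<Sum>l\<le>m. if l = m then (-1) ^ m * a m else 0)"
    by (intro sum.cong) (auto simp: alt)
  finally show ?thesis by simp
qed

lemma coeff_laguerre: "coeff (laguerre n) m = of_nat (n choose m) * ((-1) ^ m / fact m)"
  by (simp add: laguerre_def coeff_sum binomial_eq_0)

lemma coeff_p_poly:
  "coeff (p_poly n) m = of_nat (n choose m) * (-1) ^ m * (\<Sum>l\<le>m. of_nat (m choose l) * (1 / fact l))"
proof -
  have "coeff (p_poly n) m = (\<Sum>r = 0..n. if r = m then
      of_nat (n choose m) * (-1) ^ m * (\<Sum>l\<le>m. of_nat (m choose l) * (1 / fact l)) else 0)"
    unfolding p_poly_def coeff_sum
    by (intro sum.cong refl) (auto simp: sum_distrib_left atMost_atLeast0 mult_ac intro!: sum.cong)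
  then show ?thesis by (simp add: binomial_eq_0)
qed

text \<open>The falling factorial is written with \<open>fact k\<close> split off, to cancel the
  \<open>1 / fact k\<close> in \<open>diff_op\<close>.\<close>

lemma higher_pderiv_monom_binomial:
  "k \<le> n \<Longrightarrow> (pderiv ^^ k) (monom (1::'a::field_char_0) n) = smult (of_nat (n choose k) * fact k) (monom 1 (n - k))"
proof (rule poly_eqI)
  fix i assume "k \<le> n"
  \<comment> \<open>\<open>coeff_higher_pderiv\<close> yields a rising factorial starting at
    \<open>Suc i\<close>, which is the quotient of \<open>fact (i + k)\<close> by
    \<open>fact i\<close>.\<close>
  have "(fact (i + k) :: 'a) = fact i * pochhammer (1 + of_nat i) k"
    by (simp add: pochhammer_fact pochhammer_product')
  then have "pochhammer (of_nat (Suc i) :: 'a) k = of_nat ((i + k) choose k) * fact k"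
    by (simp add: binomial_fact field_simps)
  with \<open>k \<le> n\<close> show "coeff ((pderiv ^^ k) (monom (1::'a::field_char_0) n)) i
      = coeff (smult (of_nat (n choose k) * fact k) (monom 1 (n - k))) i"
    by (auto simp: coeff_higher_pderiv)
qed

text \<open>Derivatives of order above \<open>n\<close> vanish. Indexing by the remaining exponent
  \<open>j = n - k\<close> turns coefficient extraction into a shift by \<open>j\<close>.\<close>

lemma diff_op_monom:
  "diff_op p (monom 1 n) = (\<Sum>j\<le>n. smult (of_nat (n choose j)) (monom 1 j * p (n - j)))"
proof -
  have "diff_op p (monom 1 n) = (\<Sum>k\<le>n. smult (1 / fact k) (p k) * (pderiv ^^ k) (monom 1 n))"
    unfolding diff_op_def
    by (intro Sum_any.expand_superset) (auto simp: not_less[symmetric] higher_pderiv_eq_0 degree_monom_eq)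
  also have "\<dots> = (\<Sum>k\<le>n. smult (of_nat (n choose k)) (monom 1 (n - k) * p k))"
    by (intro sum.cong refl) (simp add: higher_pderiv_monom_binomial mult.commute)
  also have "\<dots> = (\<Sum>j\<le>n. smult (of_nat (n choose j)) (monom 1 j * p (n - j)))"
    by (intro sum.reindex_bij_witness[of _ "\<lambda>j. n - j" "\<lambda>k. n - k"]) (auto simp: binomial_symmetric[symmetric])
  finally show ?thesis .
qed

theorem theorem3p1:
  fixes n :: nat
  shows "laguerre n = diff_op p_poly (monom 1 n)"
proof (rule poly_eqI)
  fix m
  define c where "c r = (\<Sum>l\<le>r. of_nat (r choose l) * (1 / fact l) :: real)" for r
  have "coeff (diff_op p_poly (monom 1 n)) m =
      (\<Sum>j\<le>n. if m < j then 0 else of_nat ((n choose j) * ((n - j) choose (m - j))) * ((-1) ^ (m - j) * c (m - j)))"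
    by (auto simp: diff_op_monom coeff_sum coeff_monom_mult coeff_p_poly c_def intro!: sum.cong)
  also have "\<dots> = of_nat (n choose m) * (\<Sum>j\<le>m. of_nat (m choose j) * ((-1) ^ (m - j) * c (m - j)))"
  proof (cases "m \<le> n")
    case True
    then have "(\<Sum>j\<le>n. if m < j then 0 else of_nat ((n choose j) * ((n - j) choose (m - j))) * ((-1) ^ (m - j) * c (m - j)))
       = (\<Sum>j\<le>m. of_nat ((n choose j) * ((n - j) choose (m - j))) * ((-1) ^ (m - j) * c (m - j)))"
      by (intro sum.mono_neutral_cong_right) auto
    also have "\<dots> = (\<Sum>j\<le>m. of_nat ((n choose m) * (m choose j)) * ((-1) ^ (m - j) * c (m - j)))"
      using True by (intro sum.cong refl) (simp add: choose_mult)
    finally show ?thesis by (simp add: sum_distrib_left mult_ac)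
  next
    case False
    \<comment> \<open>For \<open>j\<close> \<le> \<open>n\<close> < \<open>m\<close> both sides
      vanish: \<open>n choose m\<close> is 0, and so is
      \<open>(n - j) choose (m - j)\<close>.\<close>
    then show ?thesis by (auto simp: binomial_eq_0 intro!: sum.neutral)
  qed
  also have "(\<Sum>j\<le>m. of_nat (m choose j) * ((-1) ^ (m - j) * c (m - j))) =
      (\<Sum>r\<le>m. of_nat (m choose r) * (-1) ^ r * c r)"
    by (intro sum.reindex_bij_witness[of _ "\<lambda>r. m - r" "\<lambda>j. m - j"]) (auto simp: binomial_symmetric[symmetric])
  also have "\<dots> = (-1) ^ m * (1 / fact m)"
    unfolding c_def by (rule binomial_inversion)
  finally show "coeff (laguerre n) m = coeff (diff_op p_poly (monom 1 n)) m"
    by (simp add: coeff_laguerre)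
qed

end
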